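(* Let $\mathcal{A}$ be a finite $\mathbb{N}$-automaton with $n$ states over a finite alphabet $A$, realising the series $s : A^*\to\mathbb{N}$. There exists an infinite $\mathbb{N}$-covering $\mathcal{B}$ of $\mathcal{A}$ such that for every integer $k>0$ there exists a finite $\mathbb{N}$-quotient $\mathcal{B}_k$ of $\mathcal{B}$ which satisfies: (i) $\mathcal{B}_k$ is an $\mathbb{N}$-covering of $\mathcal{A}$ with at most $n(k+1)^n$ states; (ii) for every $i$ with $0\le i<k$, there exists an unambiguous subautomaton $\mathcal{B}_k^{(i)}$ of $\mathcal{B}_k$ which recognises the support of $s\mathbin{-}i$; (iii) there exists a subautomaton $\mathcal{D}_k$ of $\mathcal{B}_k$ whose behaviour is $s\mathbin{-}k$.
   Context: For a series $s:A^*\to\mathbb{N}$ and $i\in\mathbb{N}$, $s\mathbin{-}i$ denotes the series obtained from $s$ by subtracting $i$ from every coefficient larger than $i$ and assigning $0$ to the others, i.e. $u\mapsto\max(s(u)-i,0)$. The support of a series is the set of words with nonzero coefficient. An $\mathbb{N}$-automaton over $A$ has a set $Q$ of states, an initial multiplicity $\lambda_p\in\mathbb{N}$ and a final multiplicity $\nu_p\in\mathbb{N}$ for each state $p$, and for each $p,q\in Q$ and $a\in A$ a multiplicity $(a\mu)_{p,q}\in\mathbb{N}$ of the transition from $p$ to $q$ labelled $a$. It is finite if $Q$ is finite. Its behaviour (the series it realises) maps $u\in A^*$ to $\lambda\cdot u\mu\cdot\nu$ (with $\mu$ extended to a matrix morphism on $A^*$), that is, to the sum of the multiplicities of the successful computations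 labelled $u$. Its split form is the automaton in which every transition of multiplicity $l>0$ is replaced by $l$ distinct transitions of multiplicity $1$ with the same origin, label and end (and similarly for initial and final multiplicities). A subautomaton is obtained from the split form of an $\mathbb{N}$-automaton by keeping only some of the states, transitions, initial and final statuses (equivalently, by decreasing multiplicities). A subautomaton is unambiguous if every word is the label of at most one of its successful computations (counted in the split form); it recognises the set of labels of its successful computations. $\mathbb{N}$-covering: an $\mathbb{N}$-automaton $\mathcal{B}$ with state set $R$ is an $\mathbb{N}$-covering of an $\mathbb{N}$-automaton $\mathcal{A}$ with state set $Q$ if there is a map $\varphi:R\to Q$ such that: for each $q\in Q$ the initial multiplicities of the states in $\varphi^{-1}(q)$ sum to the initial multiplicity of $q$; for each $r\in R$, $q\in Q$, $a\in A$, the multiplicities of the transitions labelled $a$ from $r$ to the states of $\varphi^{-1}(q)$ sum to the multiplicity of the transition labelled $a$ from $\varphi(r)$ to $q$; and each $r\in R$ has the same final multiplicity as $\varphi(r)$. Equivalently, the split form of $\mathcal{B}$ maps onto labels-preservingly to the split form of $\mathcal{A}$ by a morphism that is bijective on the outgoing transitions of each state, bijective on initial statuses, and such that a state is final exactly as its image is. When in addition $\varphi$ is surjective, $\mathcal{A}$ is called an $\mathbb{N}$-quotient of $\mathcal{B}$. *)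

theory Defs
  imports "HOL-Analysis.Infinite_Sum"
begin

record ('q, 'a) n_automaton =
  alphabet :: "'a set"
  states :: "'q set"
  initial :: "'q \<Rightarrow> nat"
  trans_mult :: "'q \<Rightarrow> 'a \<Rightarrow> 'q \<Rightarrow> nat"
  final :: "'q \<Rightarrow> nat"

text \<open>
  \<open>trans_mult X p a q\<close> is the entry $(a\mu)_{p,q}$. The multiplicities matter only
  on \<open>states X\<close> and \<open>alphabet X\<close>; their values elsewhere are ignored by every notion below.
  The set of states may be infinite.
\<close>

text \<open>Infinite sums over the discrete type \<^typ>\<open>nat\<close> converge only when almost all terms vanish.\<close>

lemma has_sum_nat_iff:
  fixes f :: "'b \<Rightarrow> nat"
  shows "(f has_sum m) S \<longleftrightarrow> finite {x \<in> S. f x \<noteq> 0} \<and> sum f {x \<in> S. f x \<noteq> 0} = m"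
proof
  assume "(f has_sum m) S"
  then have "\<forall>\<^sub>F F in finite_subsets_at_top S. sum f F = m"
    unfolding has_sum_def by (simp add: tendsto_discrete)
  then obtain F where F: "finite F" "F \<subseteq> S"
    and m: "\<And>G. finite G \<Longrightarrow> F \<subseteq> G \<Longrightarrow> G \<subseteq> S \<Longrightarrow> sum f G = m"
    unfolding eventually_finite_subsets_at_top by metis
  have z: "f x = 0" if "x \<in> S" "x \<notin> F" for x
    using m[of F] m[of "insert x F"] F that by auto
  have sub: "{x \<in> S. f x \<noteq> 0} \<subseteq> F"
  proof
    fix x assume "x \<in> {x \<in> S. f x \<noteq> 0}"
    then show "x \<in> F" using z[of x] by auto
  qed
  have "sum f {x \<in> S. f x \<noteq> 0} = sum f F"
    by (rule sum.mono_neutral_left) (use F sub in auto)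
  then show "finite {x \<in> S. f x \<noteq> 0} \<and> sum f {x \<in> S. f x \<noteq> 0} = m"
    using m[of F] F finite_subset[OF sub] by auto
next
  assume "finite {x \<in> S. f x \<noteq> 0} \<and> sum f {x \<in> S. f x \<noteq> 0} = m"
  then show "(f has_sum m) S"
    by (intro has_sum_finite_neutralI[of "{x \<in> S. f x \<noteq> 0}"]) auto
qed

text \<open>\<open>word_mult X u p q\<close> is $(u\mu)_{p,q}$.\<close>

primrec word_mult :: "('q, 'a) n_automaton \<Rightarrow> 'a list \<Rightarrow> 'q \<Rightarrow> 'q \<Rightarrow> nat" where
  "word_mult X [] p q = (if p = q then 1 else 0)"
| "word_mult X (a # u) p q = (\<Sum>\<^sub>\<infinity>r\<in>states X. trans_mult X p a r * word_mult X u r q)"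

definition behaviour :: "('q, 'a) n_automaton \<Rightarrow> 'a list \<Rightarrow> nat" where
  "behaviour X u =
    (\<Sum>\<^sub>\<infinity>p\<in>states X. \<Sum>\<^sub>\<infinity>q\<in>states X. initial X p * word_mult X u p q * final X q)"

definition realises :: "('q, 'a) n_automaton \<Rightarrow> ('a list \<Rightarrow> nat) \<Rightarrow> bool" where
  "realises X s \<longleftrightarrow> (\<forall>u\<in>lists (alphabet X). behaviour X u = s u)"

definition series_support :: "'a set \<Rightarrow> ('a list \<Rightarrow> nat) \<Rightarrow> 'a list set" where
  "series_support \<Sigma> s = {u \<in> lists \<Sigma>. s u \<noteq> 0}"

text \<open>Subtraction on \<^typ>\<open>nat\<close> is truncated at 0.\<close>

definition series_minus :: "('a list \<Rightarrow> nat) \<Rightarrow> nat \<Rightarrow> 'a list \<Rightarrow> nat" where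
  "series_minus s i = (\<lambda>u. s u - i)"

text \<open>
  Split form: the copies of a transition (or of an initial or final status) of multiplicity
  \<open>m\<close> are numbered by \<open>l < m\<close>.
\<close>

type_synonym ('q, 'a) split_edge = "'q \<times> 'a \<times> nat \<times> 'q"

definition split_initial :: "('q, 'a) n_automaton \<Rightarrow> ('q \<times> nat) set" where
  "split_initial X = {(p, l). p \<in> states X \<and> l < initial X p}"

definition split_edges :: "('q, 'a) n_automaton \<Rightarrow> ('q, 'a) split_edge set" where
  "split_edges X = {(p, a, l, q). p \<in> states X \<and> a \<in> alphabet X \<and> q \<in> states X
                                   \<and> l < trans_mult X p a q}"

definition split_final :: "('q, 'a) n_automaton \<Rightarrow> ('q \<times> nat) set" where
  "split_final X = {(p, l). p \<in> states X \<and> l < final X p}"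

fun edge_path :: "'q \<Rightarrow> ('q, 'a) split_edge list \<Rightarrow> 'q \<Rightarrow> bool" where
  "edge_path p [] q \<longleftrightarrow> p = q"
| "edge_path p ((p', a, l, r) # es) q \<longleftrightarrow> p' = p \<and> edge_path r es q"

definition successful_computations ::
  "('q, 'a) n_automaton \<Rightarrow> 'a list \<Rightarrow> (('q \<times> nat) \<times> ('q, 'a) split_edge list \<times> ('q \<times> nat)) set"
where
  "successful_computations X u =
    {(i, es, f). i \<in> split_initial X \<and> set es \<subseteq> split_edges X \<and> f \<in> split_final X
                 \<and> edge_path (fst i) es (fst f) \<and> map (\<lambda>(p, a, l, q). a) es = u}"

definition unambiguous :: "('q, 'a) n_automaton \<Rightarrow> bool" where
  "unambiguous X \<longleftrightarrow>
    (\<forall>u\<in>lists (alphabet X). \<forall>c\<in>successful_computations X u.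
       \<forall>c'\<in>successful_computations X u. c = c')"

definition recognised_language :: "('q, 'a) n_automaton \<Rightarrow> 'a list set" where
  "recognised_language X = {u \<in> lists (alphabet X). successful_computations X u \<noteq> {}}"

text \<open>
  Up to the numbering of the copies, keeping a part of the split form amounts to restricting
  the states and decreasing the multiplicities.
\<close>

definition subautomaton :: "('q, 'a) n_automaton \<Rightarrow> ('q, 'a) n_automaton \<Rightarrow> bool" where
  "subautomaton Y X \<longleftrightarrow>
     alphabet Y = alphabet X \<and> states Y \<subseteq> states X \<and>
     (\<forall>p\<in>states Y. initial Y p \<le> initial X p \<and> final Y p \<le> final X p) \<and>
     (\<forall>p\<in>states Y. \<forall>a\<in>alphabet Y. \<forall>q\<in>states Y. trans_mult Y p a q \<le> trans_mult X p a q)"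

definition covering_map ::
  "('r \<Rightarrow> 'q) \<Rightarrow> ('r, 'a) n_automaton \<Rightarrow> ('q, 'a) n_automaton \<Rightarrow> bool" where
  "covering_map \<phi> Y X \<longleftrightarrow>
     alphabet Y = alphabet X \<and>
     \<phi> ` states Y \<subseteq> states X \<and>
     (\<forall>q\<in>states X. (initial Y has_sum initial X q) {r \<in> states Y. \<phi> r = q}) \<and>
     (\<forall>r\<in>states Y. \<forall>q\<in>states X. \<forall>a\<in>alphabet X.
        (trans_mult Y r a has_sum trans_mult X (\<phi> r) a q) {r' \<in> states Y. \<phi> r' = q}) \<and>
     (\<forall>r\<in>states Y. final Y r = final X (\<phi> r))"

definition is_covering_of :: "('r, 'a) n_automaton \<Rightarrow> ('q, 'a) n_automaton \<Rightarrow> bool" where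
  "is_covering_of Y X \<longleftrightarrow> (\<exists>\<phi>. covering_map \<phi> Y X)"

definition is_quotient_of :: "('q, 'a) n_automaton \<Rightarrow> ('r, 'a) n_automaton \<Rightarrow> bool" where
  "is_quotient_of X Y \<longleftrightarrow> (\<exists>\<phi>. covering_map \<phi> Y X \<and> \<phi> ` states Y = states X)"

end

theory Submission
  imports Defs
begin

text \<open>
  Order the split edges leaving each state with a given label, and order computations with the same
  label lexicographically. The covering remembers, next to the current state, the vector that counts
  for each state \<open>q\<close> the smaller computations with the same label that end in \<open>q\<close>. The product of
  this vector with the final vector gives the rank of a successful computation among all those with
  the same label, and these ranks are exactly the numbers below \<open>s u\<close>. Keeping the final statuses of
  rank \<open>i\<close> thus selects one computation for each \<open>u\<close> with \<open>s u > i\<close>, and keeping those of rank at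
  least \<open>k\<close> realises \<open>s - k\<close>. For these purposes counting up to \<open>k\<close> suffices, since truncation at \<open>k\<close>
  is a congruence of the semiring of natural numbers.
\<close>

section \<open>Computations of a finite automaton\<close>

text \<open>The middle part of a successful computation, without the copies of the initial and final
  statuses. With both ends as parameters it can be peeled off at the first letter, as
  \<open>word_mult\<close> is.\<close>

definition split_paths ::
  "('q, 'a) n_automaton \<Rightarrow> 'q \<Rightarrow> 'a list \<Rightarrow> 'q \<Rightarrow> ('q, 'a) split_edge list set" where
  "split_paths X p u q =
    {es. set es \<subseteq> split_edges X \<and> edge_path p es q \<and> map (\<lambda>(p, a, l, q). a) es = u}"

lemma split_paths_Nil: "split_paths X p [] q = (if p = q then {[]} else {})"
  by (auto simp: split_paths_def)

lemma split_paths_Cons: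
  assumes "p \<in> states X" "a \<in> alphabet X"
  shows "split_paths X p (a # u) q =
    (\<Union>r\<in>states X. (\<lambda>(l, es). (p, a, l, r) # es) ` ({..<trans_mult X p a r} \<times> split_paths X r u q))"
    (is "?L = ?R")
proof
  show "?L \<subseteq> ?R"
  proof
    fix es assume es: "es \<in> ?L"
    then obtain e es' where e: "es = e # es'" by (auto simp: split_paths_def)
    obtain p' b l r where e': "e = (p', b, l, r)" by (cases e) auto
    show "es \<in> ?R"
      using es unfolding e e' split_paths_def split_edges_def
      by (auto intro!: bexI[of _ r] image_eqI[of _ _ "(l, es')"])
  qed
  show "?R \<subseteq> ?L"
    using assms by (auto simp: split_paths_def split_edges_def)
qed

text \<open>Sorting the paths by the target of the first edge gives disjoint pieces, each a copy of
  a product, so the cardinality obeys the recursion of \<open>word_mult\<close>.\<close>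

lemma card_split_paths:
  assumes fin: "finite (states X)" and "u \<in> lists (alphabet X)" "p \<in> states X"
  shows "finite (split_paths X p u q) \<and> card (split_paths X p u q) = word_mult X u p q"
  using assms(2,3)
proof (induction u arbitrary: p)
  case Nil
  then show ?case by (simp add: split_paths_Nil)
next
  case (Cons a u)
  let ?S = "\<lambda>r. (\<lambda>(l, es). (p, a, l, r) # es) ` ({..<trans_mult X p a r} \<times> split_paths X r u q)"
  have IH: "finite (split_paths X r u q)" "card (split_paths X r u q) = word_mult X u r q"
    if "r \<in> states X" for r
    using Cons that by auto
  have inj: "inj_on (\<lambda>(l, es). (p, a, l, r) # es) M" for r and M :: "(nat \<times> _) set"
    by (auto simp: inj_on_def)
  have eq: "split_paths X p (a # u) q = (\<Union>r\<in>states X. ?S r)"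
    by (rule split_paths_Cons) (use Cons.prems Cons.hyps in simp_all)
  have "card (\<Union>r\<in>states X. ?S r) = (\<Sum>r\<in>states X. card (?S r))"
    by (rule card_UN_disjoint) (use fin IH in auto)
  also have "\<dots> = (\<Sum>r\<in>states X. trans_mult X p a r * word_mult X u r q)"
    by (intro sum.cong refl) (simp add: card_image[OF inj] card_cartesian_product IH)
  finally show ?case
    unfolding eq using fin IH by auto
qed

text \<open>Turns unambiguity and recognition, which speak of the split form, into conditions on the
  coefficients of the behaviour.\<close>

lemma card_successful_computations:
  assumes fin: "finite (states X)" and u: "u \<in> lists (alphabet X)"
  shows "finite (successful_computations X u)"
    and "card (successful_computations X u) = behaviour X u"
proof -
  let ?S = "\<lambda>(p, q). (\<lambda>(i, es, f). ((p, i), es, (q, f))) `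
    ({..<initial X p} \<times> split_paths X p u q \<times> {..<final X q})"
  have eq: "successful_computations X u = (\<Union>x\<in>states X \<times> states X. ?S x)"
    unfolding successful_computations_def split_initial_def split_final_def split_paths_def
    by (auto simp: image_iff)
  have P: "finite (split_paths X p u q)" "card (split_paths X p u q) = word_mult X u p q"
    if "p \<in> states X" for p q
    using card_split_paths[OF fin u that] by auto
  have c: "card (?S (p, q)) = initial X p * word_mult X u p q * final X q" if "p \<in> states X" for p q
  proof -
    have "inj_on (\<lambda>(i, es, f). ((p, i), es, (q, f)))
        ({..<initial X p} \<times> split_paths X p u q \<times> {..<final X q})"
      by (auto simp: inj_on_def)
    from card_image[OF this] show ?thesis
      using that by (simp add: card_cartesian_product P)
  qed
  show "finite (successful_computations X u)"
    unfolding eq using fin P by auto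
  have "card (\<Union>x\<in>states X \<times> states X. ?S x) = (\<Sum>x\<in>states X \<times> states X. card (?S x))"
    by (rule card_UN_disjoint) (use fin P in auto)
  also have "\<dots> = (\<Sum>p\<in>states X. \<Sum>q\<in>states X. card (?S (p, q)))"
    by (simp only: sum.cartesian_product) (auto intro!: sum.cong)
  also have "\<dots> = (\<Sum>p\<in>states X. \<Sum>q\<in>states X. initial X p * word_mult X u p q * final X q)"
    by (intro sum.cong refl c)
  also have "\<dots> = behaviour X u"
    by (simp add: behaviour_def fin)
  finally show "card (successful_computations X u) = behaviour X u"
    unfolding eq .
qed

lemma unambiguousI:
  assumes "finite (states X)" "\<And>u. u \<in> lists (alphabet X) \<Longrightarrow> behaviour X u \<le> 1"
  shows "unambiguous X"
  unfolding unambiguous_def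
  using card_successful_computations[OF assms(1)] assms(2) by (metis One_nat_def card_le_Suc0_iff_eq)

lemma recognised_language_eq_support:
  assumes "finite (states X)"
  shows "recognised_language X = series_support (alphabet X) (behaviour X)"
  unfolding recognised_language_def series_support_def
  using card_successful_computations[OF assms] by (metis card_eq_0_iff)

section \<open>Automata given by ordered lists of successors\<close>

text \<open>The set \<open>S\<close> may be infinite: the count vanishes off the finitely many
  entries of \<open>L\<close>, so only a finite sum remains.\<close>

lemma sum_list_map_eq_infsum_count:
  fixes f :: "'b \<Rightarrow> nat"
  assumes "set L \<subseteq> S"
  shows "(\<Sum>\<^sub>\<infinity>r\<in>S. count_list L r * f r) = sum_list (map f L)"
proof -
  have "(\<Sum>\<^sub>\<infinity>r\<in>S. count_list L r * f r) = (\<Sum>\<^sub>\<infinity>r\<in>set L. count_list L r * f r)"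
    by (rule infsum_cong_neutral) (use assms in \<open>auto simp: count_list_0_iff\<close>)
  then show ?thesis by (simp add: sum_list_map_eq_sum_count)
qed

text \<open>This is the sum condition of a covering, obtained whenever a list upstairs is mapped
  entry by entry to the list downstairs.\<close>

lemma has_sum_count_list_fibre:
  assumes "set L \<subseteq> S"
  shows "(count_list L has_sum count_list (map \<phi> L) q) {r \<in> S. \<phi> r = q}"
proof (rule has_sum_finite_neutralI)
  let ?F = "{r \<in> set L. \<phi> r = q}"
  have "count_list (map \<phi> L) q = sum_list (map (\<lambda>r. of_bool (\<phi> r = q)) L)"
    by (induction L) auto
  also have "\<dots> = (\<Sum>r\<in>set L. if \<phi> r = q then count_list L r else 0)"
    by (simp add: sum_list_map_eq_sum_count of_bool_def if_distrib cong: if_cong)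
  also have "\<dots> = sum (count_list L) ?F"
    by (simp add: sum.inter_filter)
  finally show "count_list (map \<phi> L) q = sum (count_list L) ?F" .
qed (use assms in \<open>auto simp: count_list_0_iff\<close>)

lemma sum_list_concat: "sum_list (concat Ls) = sum_list (map sum_list Ls)"
  by (induction Ls) simp_all

text \<open>The end states of all computations on a word, one entry per computation, in
  lexicographic order when \<open>L\<close> lists the initial statuses and \<open>T\<close> the
  outgoing edges.\<close>

definition run :: "('q \<Rightarrow> 'a \<Rightarrow> 'q list) \<Rightarrow> 'q list \<Rightarrow> 'a list \<Rightarrow> 'q list" where
  "run T = foldl (\<lambda>L a. concat (map (\<lambda>p. T p a) L))"

lemma run_simps [simp]:
  "run T L [] = L"
  "run T L (a # u) = run T (concat (map (\<lambda>p. T p a) L)) u"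
  "run T L (u @ [a]) = concat (map (\<lambda>p. T p a) (run T L u))"
  by (simp_all add: run_def)

lemma run_append_states: "run T (L @ M) u = run T L u @ run T M u"
  by (induction u arbitrary: L M) simp_all

lemma run_eq_concat: "run T L u = concat (map (\<lambda>p. run T [p] u) L)"
proof (induction L)
  case Nil
  show ?case by (induction u) simp_all
next
  case (Cons p L)
  then show ?case using run_append_states[of T "[p]" L u] by simp
qed

text \<open>Possibly infinite automata with finite branching. The lists carry the multiplicities as
  counts and, in addition, an order on the edges.\<close>

locale listed_automaton =
  fixes X :: "('q, 'a) n_automaton" and I :: "'q list" and T :: "'q \<Rightarrow> 'a \<Rightarrow> 'q list"
  assumes I_subset: "set I \<subseteq> states X"
    and initial_eq: "r \<in> states X \<Longrightarrow> initial X r = count_list I r"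
    and T_subset: "p \<in> states X \<Longrightarrow> set (T p a) \<subseteq> states X"
    and trans_eq: "p \<in> states X \<Longrightarrow> r \<in> states X \<Longrightarrow> trans_mult X p a r = count_list (T p a) r"
begin

lemma run_subset: "set L \<subseteq> states X \<Longrightarrow> set (run T L u) \<subseteq> states X"
proof (induction u arbitrary: L)
  case (Cons a u)
  have "set (concat (map (\<lambda>p. T p a) L)) \<subseteq> states X"
    using Cons.prems T_subset by fastforce
  from Cons.IH[OF this] show ?case by simp
qed simp

lemma word_mult_eq:
  "p \<in> states X \<Longrightarrow> q \<in> states X \<Longrightarrow> word_mult X u p q = count_list (run T [p] u) q"
proof (induction u arbitrary: p)
  case (Cons a u)
  have "word_mult X (a # u) p q
      = (\<Sum>\<^sub>\<infinity>r\<in>states X. count_list (T p a) r * count_list (run T [r] u) q)"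
    using Cons by (auto intro!: infsum_cong simp: trans_eq)
  also have "\<dots> = sum_list (map (\<lambda>r. count_list (run T [r] u) q) (T p a))"
    by (rule sum_list_map_eq_infsum_count) (rule T_subset[OF Cons.prems(1)])
  also have "\<dots> = count_list (concat (map (\<lambda>r. run T [r] u) (T p a))) q"
    by (simp add: count_list_concat o_def)
  also have "\<dots> = count_list (run T [p] (a # u)) q"
    by (simp add: run_eq_concat[of T "T p a"])
  finally show ?case .
qed simp

lemma behaviour_eq: "behaviour X u = sum_list (map (final X) (run T I u))"
proof -
  have 1: "(\<Sum>\<^sub>\<infinity>q\<in>states X. initial X p * word_mult X u p q * final X q)
      = count_list I p * sum_list (map (final X) (run T [p] u))" if p: "p \<in> states X" for p
  proof -
    have "(\<Sum>\<^sub>\<infinity>q\<in>states X. initial X p * word_mult X u p q * final X q)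
      = (\<Sum>\<^sub>\<infinity>q\<in>states X. count_list (run T [p] u) q * (count_list I p * final X q))"
      using p by (intro infsum_cong) (simp add: initial_eq word_mult_eq)
    also have "\<dots> = sum_list (map (\<lambda>q. count_list I p * final X q) (run T [p] u))"
      by (rule sum_list_map_eq_infsum_count) (rule run_subset, use p in simp)
    finally show ?thesis by (simp add: sum_list_const_mult)
  qed
  have "behaviour X u
      = (\<Sum>\<^sub>\<infinity>p\<in>states X. count_list I p * sum_list (map (final X) (run T [p] u)))"
    unfolding behaviour_def by (intro infsum_cong 1)
  also have "\<dots> = sum_list (map (\<lambda>p. sum_list (map (final X) (run T [p] u))) I)"
    by (rule sum_list_map_eq_infsum_count) (rule I_subset)
  also have "\<dots> = sum_list (map (final X) (run T I u))"
    by (simp add: run_eq_concat[of T I] map_concat sum_list_concat o_def)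
  finally show ?thesis .
qed

end

text \<open>Reduces the sums over fibres to equations between lists, which is how both the covering
  of \<open>A\<close> and the quotient maps are checked.\<close>

lemma covering_mapI:
  assumes Y: "listed_automaton Y J U" and X: "listed_automaton X I T"
    and "alphabet Y = alphabet X" and \<phi>: "\<phi> ` states Y \<subseteq> states X"
    and I: "I = map \<phi> J" and T: "\<And>r a. r \<in> states Y \<Longrightarrow> T (\<phi> r) a = map \<phi> (U r a)"
    and "\<And>r. r \<in> states Y \<Longrightarrow> final Y r = final X (\<phi> r)"
  shows "covering_map \<phi> Y X"
proof -
  interpret Y: listed_automaton Y J U by (rule Y)
  interpret X: listed_automaton X I T by (rule X)
  have "(initial Y has_sum initial X q) {r \<in> states Y. \<phi> r = q}" if "q \<in> states X" for q
  proof -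
    have "(initial Y has_sum count_list I q) {r \<in> states Y. \<phi> r = q}"
      using has_sum_count_list_fibre[OF Y.I_subset, of \<phi> q]
      by (subst has_sum_cong[where g = "count_list J"]) (simp_all add: I Y.initial_eq)
    then show ?thesis using that by (simp add: X.initial_eq)
  qed
  moreover have "(trans_mult Y r a has_sum trans_mult X (\<phi> r) a q) {r' \<in> states Y. \<phi> r' = q}"
    if "r \<in> states Y" "q \<in> states X" for r q a
  proof -
    have "(trans_mult Y r a has_sum count_list (T (\<phi> r) a) q) {r' \<in> states Y. \<phi> r' = q}"
      using has_sum_count_list_fibre[OF Y.T_subset[OF that(1)], of a \<phi> q] that(1)
      by (subst has_sum_cong[where g = "count_list (U r a)"]) (simp_all add: T Y.trans_eq)
    moreover have "\<phi> r \<in> states X" using that(1) \<phi> by blast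
    ultimately show ?thesis using that by (simp add: X.trans_eq)
  qed
  ultimately show ?thesis
    using assms by (simp add: covering_map_def)
qed

section \<open>Counting smaller computations\<close>

text \<open>The vector attached to an entry counts the earlier entries state by state. The start
  vector \<open>v\<close> accounts for what precedes the list, so that blocks of a longer list can
  be annotated separately.\<close>

primrec annotate :: "('q \<Rightarrow> nat) \<Rightarrow> 'q list \<Rightarrow> ('q \<times> ('q \<Rightarrow> nat)) list" where
  "annotate v [] = []"
| "annotate v (x # xs) = (x, v) # annotate (v(x := Suc (v x))) xs"

lemma annotate_append:
  "annotate v (xs @ ys) = annotate v xs @ annotate (\<lambda>q. v q + count_list xs q) ys"
proof (induction xs arbitrary: v)
  case (Cons x xs)
  have "(\<lambda>q. (v(x := Suc (v x))) q + count_list xs q) = (\<lambda>q. v q + count_list (x # xs) q)"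
    by auto
  then show ?case using Cons by (simp del: fun_upd_apply)
qed simp

lemma map_fst_annotate: "map fst (annotate v xs) = xs"
  by (induction xs arbitrary: v) simp_all

lemma annotate_support:
  assumes "(x, w) \<in> set (annotate v xs)" "set xs \<subseteq> Q" "\<forall>q. q \<notin> Q \<longrightarrow> v q = 0"
  shows "x \<in> Q \<and> (\<forall>q. q \<notin> Q \<longrightarrow> w q = 0)"
  using assms by (induction xs arbitrary: v) (auto split: if_splits)

definition listing :: "'q list \<Rightarrow> ('q \<Rightarrow> nat) \<Rightarrow> 'q list" where
  "listing qs f = concat (map (\<lambda>q. replicate (f q) q) qs)"

lemma set_listing: "set (listing qs f) \<subseteq> set qs"
  by (auto simp: listing_def)

lemma count_list_replicate': "count_list (replicate n x) y = (if x = y then n else 0)"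
  by (induction n) auto

lemma count_listing: "distinct qs \<Longrightarrow> count_list (listing qs f) q = (if q \<in> set qs then f q else 0)"
  unfolding listing_def by (induction qs) (auto simp: count_list_replicate')

text \<open>The kernel of \<open>t\<close> is a congruence of the semiring of natural numbers, with
  \<open>t x\<close> as representative of the class of \<open>x\<close>. Two cases matter:
  \<open>id\<close> for the infinite covering, \<open>min k\<close> for the finite ones.\<close>

locale truncation =
  fixes t :: "nat \<Rightarrow> nat"
  assumes t_0 [simp]: "t 0 = 0"
    and t_add: "t (t x + y) = t (x + y)"
    and t_mult: "t (t x * y) = t (x * y)"
begin

lemma t_idem [simp]: "t (t x) = t x"
  using t_add[of x 0] by simp

lemma t_add2: "t x = t x' \<Longrightarrow> t y = t y' \<Longrightarrow> t (x + y) = t (x' + y')"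
  by (metis t_add add.commute)

lemma t_sum: "t (\<Sum>q\<in>Q. t (v q) * f q) = t (\<Sum>q\<in>Q. v q * f q)"
  by (induction Q rule: infinite_finite_induct) (auto intro: t_add2 t_mult)

abbreviation trunc :: "'q \<times> ('q \<Rightarrow> nat) \<Rightarrow> 'q \<times> ('q \<Rightarrow> nat)" where
  "trunc \<equiv> apsnd ((\<circ>) t)"

text \<open>Counting one more entry respects the congruence, so a vector known only up to
  \<open>t\<close> determines the later vectors up to \<open>t\<close>.\<close>

lemma trunc_annotate_cong:
  "t \<circ> v = t \<circ> w \<Longrightarrow> map trunc (annotate v xs) = map trunc (annotate w xs)"
proof (induction xs arbitrary: v w)
  case (Cons x xs)
  have "t (Suc (v x)) = t (Suc (w x))"
    using t_add2[of "v x" "w x" 1 1] Cons.prems by (simp add: fun_eq_iff)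
  then have "t \<circ> v(x := Suc (v x)) = t \<circ> w(x := Suc (w x))"
    using Cons.prems by (simp add: fun_eq_iff)
  from Cons.IH[OF this] show ?case
    by (simp only: annotate.simps list.map apsnd_conv Cons.prems)
qed simp

end

interpretation id_truncation: truncation id
  by unfold_locales auto

lemma truncation_min: "truncation (min k)"
proof
  show "min k (min k x * y) = min k (x * y)" for x y
    \<comment> \<open>If \<open>y > 0\<close> and \<open>k \<le> x\<close>, both products are at
      least \<open>k\<close>; the other cases are direct.\<close>
    by (cases "y = 0"; cases "k \<le> x") (auto simp: min_def intro: order_trans)
qed auto

section \<open>The lexicographic covering\<close>

locale ordered_automaton =
  fixes A :: "('q, 'a) n_automaton" and qs :: "'q list"
  assumes distinct_qs: "distinct qs" and set_qs: "set qs = states A"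
begin

definition succs :: "'q \<Rightarrow> 'a \<Rightarrow> 'q list" where
  "succs p a = listing qs (trans_mult A p a)"

definition inits :: "'q list" where
  "inits = listing qs (initial A)"

definition dot :: "('q \<Rightarrow> nat) \<Rightarrow> ('q \<Rightarrow> nat) \<Rightarrow> nat" where
  "dot v f = (\<Sum>q\<in>states A. v q * f q)"

text \<open>The product of the row vector \<open>v\<close> with the matrix of \<open>a\<close>: if
  \<open>v\<close> counts computations by end state, this counts their extensions by
  \<open>a\<close>. The value 0 elsewhere keeps a vector determined by its values on the
  states.\<close>

definition act :: "('q \<Rightarrow> nat) \<Rightarrow> 'a \<Rightarrow> 'q \<Rightarrow> nat" where
  "act v a q = (if q \<in> states A then dot v (\<lambda>p. trans_mult A p a q) else 0)"

lemma finite_states: "finite (states A)"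
  using set_qs by (metis finite_set)

lemma listed_self: "listed_automaton A inits succs"
  using set_listing[of qs] set_qs distinct_qs
  by unfold_locales (auto simp: inits_def succs_def count_listing)

sublocale self: listed_automaton A inits succs
  by (rule listed_self)

lemma dot_upd: "x \<in> states A \<Longrightarrow> dot (v(x := Suc (v x))) f = dot v f + f x"
  using finite_states by (simp add: dot_def sum.remove[of _ x])

lemma act_upd: "x \<in> states A \<Longrightarrow> act (v(x := Suc (v x))) a = (\<lambda>q. act v a q + count_list (succs x a) q)"
  by (auto simp: act_def dot_upd succs_def count_listing distinct_qs set_qs)

text \<open>Below an extended computation lie the extensions of smaller computations, counted by
  \<open>act w a\<close>, and the smaller extensions of the same computation, counted inside
  \<open>succs p a\<close>. Hence the new vector depends only on the old state, the old vector and
  the edge.\<close>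

lemma annotate_act:
  assumes "set xs \<subseteq> states A"
  shows "annotate (act v a) (concat (map (\<lambda>p. succs p a) xs))
    = concat (map (\<lambda>(p, w). annotate (act w a) (succs p a)) (annotate v xs))"
  using assms
proof (induction xs arbitrary: v)
  case (Cons x xs)
  then have "act (v(x := Suc (v x))) a = (\<lambda>q. act v a q + count_list (succs x a) q)"
    by (simp add: act_upd)
  then show ?case
    using Cons by (simp add: annotate_append flip: Cons.IH del: fun_upd_apply)
qed simp

text \<open>Passing an entry \<open>x\<close> raises \<open>dot v f\<close> by \<open>f x\<close>,
  so the final copies at successive entries have ranks that fill consecutive intervals. Every rank
  of the total interval occurs once, and \<open>R\<close> selects among them.\<close>

lemma sum_list_card_ranks:
  assumes "set xs \<subseteq> states A"
  shows "sum_list (map (\<lambda>(p, w). card {l. l < f p \<and> dot w f + l \<in> R}) (annotate v xs))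
    = card {j \<in> R. dot v f \<le> j \<and> j < dot v f + sum_list (map f xs)}"
  using assms
proof (induction xs arbitrary: v)
  case (Cons x xs)
  let ?d = "dot v f" and ?e = "dot v f + f x" and ?m = "sum_list (map f xs)"
  \<comment> \<open>A copy number \<open>l\<close> at the first entry becomes a rank by the shift
    \<open>?d + l\<close>.\<close>
  have "(+) ?d ` {l. l < f x \<and> ?d + l \<in> R} = {j \<in> R. ?d \<le> j \<and> j < ?e}"
  proof (intro equalityI subsetI)
    fix j assume "j \<in> {j \<in> R. ?d \<le> j \<and> j < ?e}"
    then show "j \<in> (+) ?d ` {l. l < f x \<and> ?d + l \<in> R}"
      by (intro image_eqI[of _ _ "j - ?d"]) auto
  qed auto
  then have 1: "card {l. l < f x \<and> ?d + l \<in> R} = card {j \<in> R. ?d \<le> j \<and> j < ?e}"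
    using card_image[of "(+) ?d" "{l. l < f x \<and> ?d + l \<in> R}"] by simp
  have "card {j \<in> R. ?d \<le> j \<and> j < ?d + (f x + ?m)}
      = card ({j \<in> R. ?d \<le> j \<and> j < ?e} \<union> {j \<in> R. ?e \<le> j \<and> j < ?e + ?m})"
    by (rule arg_cong[where f = card]) auto
  also have "\<dots> = card {j \<in> R. ?d \<le> j \<and> j < ?e} + card {j \<in> R. ?e \<le> j \<and> j < ?e + ?m}"
    by (rule card_Un_disjoint) auto
  finally have 2: "card {j \<in> R. ?d \<le> j \<and> j < ?d + (f x + ?m)}
      = card {j \<in> R. ?d \<le> j \<and> j < ?e} + card {j \<in> R. ?e \<le> j \<and> j < ?e + ?m}" .
  have "dot (v(x := Suc (v x))) f = ?e"
    using Cons.prems by (intro dot_upd) simp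
  with Cons.IH[of "v(x := Suc (v x))"] Cons.prems show ?case
    by (simp only: annotate.simps list.map sum_list.Cons case_prod_conv 1 2 list.set insert_subset)
qed simp

lemma annotate_run_snoc:
  "annotate (\<lambda>_. 0) (run succs inits (u @ [a]))
    = concat (map (\<lambda>(p, w). annotate (act w a) (succs p a)) (annotate (\<lambda>_. 0) (run succs inits u)))"
proof -
  \<comment> \<open>The zero vector, meaning that nothing precedes the list, is fixed by every
    letter.\<close>
  have "act (\<lambda>_. 0) a = (\<lambda>_. 0)"
    by (auto simp: act_def dot_def)
  then show ?thesis
    using annotate_act[OF self.run_subset[OF self.I_subset], of "\<lambda>_. 0" a u] by simp
qed

end

section \<open>The covering for a given truncation, and its parts selected by rank\<close>

locale truncated_ordered_automaton = ordered_automaton A qs + truncation t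
  for A :: "('q, 'a) n_automaton" and qs :: "'q list" and t :: "nat \<Rightarrow> nat"
begin

definition lex_inits :: "('q \<times> ('q \<Rightarrow> nat)) list" where
  "lex_inits = map trunc (annotate (\<lambda>_. 0) inits)"

definition lex_succs :: "'q \<times> ('q \<Rightarrow> nat) \<Rightarrow> 'a \<Rightarrow> ('q \<times> ('q \<Rightarrow> nat)) list" where
  "lex_succs r a = map trunc (annotate (act (snd r) a) (succs (fst r) a))"

definition vectors :: "('q \<Rightarrow> nat) set" where
  "vectors = {v. range v \<subseteq> range t \<and> (\<forall>q. q \<notin> states A \<longrightarrow> v q = 0)}"

text \<open>All of \<open>vectors\<close> is kept, whether reached by a computation or not; this
  makes the untruncated covering infinite even when few vectors are reached.\<close>

definition lex_covering :: "('q \<times> ('q \<Rightarrow> nat), 'a) n_automaton" where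
  "lex_covering = \<lparr>alphabet = alphabet A, states = states A \<times> vectors,
     initial = count_list lex_inits, trans_mult = (\<lambda>r a. count_list (lex_succs r a)),
     final = (\<lambda>r. final A (fst r))\<rparr>"

text \<open>
  \<open>dot v (final A) + l\<close> is the rank of a computation ending with copy \<open>l\<close> of the final status of
  \<open>(p, v)\<close>, up to the truncation \<open>t\<close>.
\<close>

definition ranked_final :: "nat set \<Rightarrow> 'q \<times> ('q \<Rightarrow> nat) \<Rightarrow> nat" where
  "ranked_final R = (\<lambda>(p, v). card {l. l < final A p \<and> dot v (final A) + l \<in> R})"

definition ranked_part :: "nat set \<Rightarrow> ('q \<times> ('q \<Rightarrow> nat), 'a) n_automaton" where
  "ranked_part R = lex_covering\<lparr>final := ranked_final R\<rparr>"

lemma trunc_annotate_subset: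
  assumes "set xs \<subseteq> states A" "\<forall>q. q \<notin> states A \<longrightarrow> v q = 0"
  shows "set (map trunc (annotate v xs)) \<subseteq> states A \<times> vectors"
  by (auto simp: vectors_def dest!: annotate_support[OF _ assms])

lemma lex_inits_subset: "set lex_inits \<subseteq> states A \<times> vectors"
  unfolding lex_inits_def by (rule trunc_annotate_subset) (auto dest: self.I_subset[THEN subsetD])

lemma lex_succs_subset: "r \<in> states A \<times> vectors \<Longrightarrow> set (lex_succs r a) \<subseteq> states A \<times> vectors"
  unfolding lex_succs_def
  by (rule trunc_annotate_subset) (auto simp: act_def dest: self.T_subset[THEN subsetD])

lemma listed_lex_covering: "listed_automaton lex_covering lex_inits lex_succs"
  using lex_inits_subset lex_succs_subset by unfold_locales (auto simp: lex_covering_def)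

lemma listed_ranked_part: "listed_automaton (ranked_part R) lex_inits lex_succs"
  using lex_inits_subset lex_succs_subset
  by unfold_locales (auto simp: lex_covering_def ranked_part_def)

text \<open>Since \<open>act\<close> is linear it respects the congruence, so truncating the vector
  before reading a letter does not affect the truncated result. Both the runs and the quotient map
  rest on this.\<close>

lemma lex_succs_trunc:
  "lex_succs (trunc r) a = map trunc (annotate (act (snd r) a) (succs (fst r) a))"
proof -
  have "t \<circ> act (t \<circ> snd r) a = t \<circ> act (snd r) a"
    by (auto simp: act_def dot_def t_sum fun_eq_iff)
  from trunc_annotate_cong[OF this] show ?thesis
    by (simp add: lex_succs_def)
qed

text \<open>Induction on the last letter: \<open>annotate_run_snoc\<close> extends the exact
  vectors, and \<open>lex_succs_trunc\<close> absorbs the truncations already made.\<close>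

lemma run_lex: "run lex_succs lex_inits u = map trunc (annotate (\<lambda>_. 0) (run succs inits u))"
proof (induction u rule: rev_induct)
  case Nil
  show ?case by (simp only: run_simps lex_inits_def)
next
  case (snoc a u)
  have "(\<lambda>r. lex_succs r a) \<circ> trunc = map trunc \<circ> (\<lambda>(p, w). annotate (act w a) (succs p a))"
    by (rule ext) (simp only: comp_apply lex_succs_trunc case_prod_unfold)
  then show ?case
    unfolding annotate_run_snoc by (simp only: run_simps snoc map_concat list.map_comp)
qed

text \<open>The hypothesis makes \<open>R\<close> a union of classes of \<open>t\<close>, so a rank
  computed from a truncated vector decides whether the exact rank is in \<open>R\<close>. Exact
  ranks start at 0, as the initial vector is zero, and fill the numbers below the coefficient of
  \<open>u\<close>.\<close>

lemma behaviour_ranked_part: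
  assumes R: "\<And>x. t x \<in> R \<longleftrightarrow> x \<in> R"
  shows "behaviour (ranked_part R) u = card {j \<in> R. j < behaviour A u}"
proof -
  interpret listed_automaton "ranked_part R" lex_inits lex_succs
    by (rule listed_ranked_part)
  have "t (dot (t \<circ> w) (final A) + l) = t (dot w (final A) + l)" for w l
    by (intro t_add2) (simp_all add: dot_def t_sum)
  then have "dot (t \<circ> w) (final A) + l \<in> R \<longleftrightarrow> dot w (final A) + l \<in> R" for w l
    by (metis R)
  then have "behaviour (ranked_part R) u = sum_list (map
      (\<lambda>(p, w). card {l. l < final A p \<and> dot w (final A) + l \<in> R})
      (annotate (\<lambda>_. 0) (run succs inits u)))"
    unfolding behaviour_eq run_lex
    by (simp add: ranked_part_def ranked_final_def o_def case_prod_unfold)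
  also have "\<dots> = card {j \<in> R. j < behaviour A u}"
    using sum_list_card_ranks[OF self.run_subset[OF self.I_subset], of "final A" R "\<lambda>_. 0" u]
    by (simp add: self.behaviour_eq dot_def)
  finally show ?thesis .
qed

lemma subautomaton_ranked_part: "subautomaton (ranked_part R) lex_covering"
proof -
  have "ranked_final R r \<le> final A (fst r)" for r
    using card_mono[of "{..<final A (fst r)}"
        "{l. l < final A (fst r) \<and> dot (snd r) (final A) + l \<in> R}"]
    by (auto simp: ranked_final_def case_prod_unfold)
  then show ?thesis
    by (auto simp: subautomaton_def ranked_part_def lex_covering_def)
qed

lemma covering_fst: "covering_map fst lex_covering A"
proof (rule covering_mapI[OF listed_lex_covering listed_self])
  have *: "map fst (map trunc xs) = map fst xs" for xs :: "('q \<times> ('q \<Rightarrow> nat)) list"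
    by (simp add: o_def)
  show "inits = map fst lex_inits"
    unfolding lex_inits_def * by (simp add: map_fst_annotate)
  show "succs (fst r) a = map fst (lex_succs r a)" for r a
    unfolding lex_succs_def * by (simp add: map_fst_annotate)
qed (auto simp: lex_covering_def)

end

section \<open>The infinite covering and its finite quotients\<close>

context ordered_automaton
begin

sublocale full: truncated_ordered_automaton A qs id
  by unfold_locales

lemma infinite_full_covering:
  assumes "states A \<noteq> {}"
  shows "infinite (states full.lex_covering)"
proof
  assume fin: "finite (states full.lex_covering)"
  obtain q where q: "q \<in> states A" using assms by blast
  \<comment> \<open>These vectors are concentrated at \<open>q\<close>, with an arbitrary value
    there.\<close>
  have "inj (\<lambda>m::nat. (q, (\<lambda>_. 0)(q := m)))"
    by (auto simp: inj_def fun_eq_iff split: if_splits)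
  moreover have "range (\<lambda>m::nat. (q, (\<lambda>_. 0)(q := m))) \<subseteq> states full.lex_covering"
    using q by (auto simp: full.lex_covering_def full.vectors_def)
  ultimately show False
    using fin by (meson finite_imageD finite_subset infinite_UNIV_nat)
qed

end

context truncated_ordered_automaton
begin

text \<open>The quotient map truncates the vectors. It is onto because values in the range of
  \<open>t\<close> are fixed by \<open>t\<close>, so each truncated state is its own
  preimage.\<close>

lemma quotient_of_full: "is_quotient_of lex_covering full.lex_covering"
  unfolding is_quotient_of_def
proof (intro exI conjI)
  \<comment> \<open>Truncation by the identity does nothing, so the lists of the full covering are
    the exact annotations.\<close>
  have *: "apsnd ((\<circ>) id) = (id :: 'q \<times> ('q \<Rightarrow> nat) \<Rightarrow> _)"
    by (auto simp: fun_eq_iff)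
  show img: "trunc ` states full.lex_covering = states lex_covering"
  proof
    show "trunc ` states full.lex_covering \<subseteq> states lex_covering"
      by (auto simp: full.lex_covering_def full.vectors_def lex_covering_def vectors_def)
    show "states lex_covering \<subseteq> trunc ` states full.lex_covering"
    proof
      fix r assume r: "r \<in> states lex_covering"
      have "t (snd r q) = snd r q" for q
      proof -
        have "snd r q \<in> range t"
          using r by (auto simp: lex_covering_def vectors_def)
        then show ?thesis by auto
      qed
      then have "trunc r = r" by (cases r) (auto simp: fun_eq_iff)
      moreover have "r \<in> states full.lex_covering"
        using r by (auto simp: full.lex_covering_def full.vectors_def lex_covering_def vectors_def)
      ultimately show "r \<in> trunc ` states full.lex_covering" by (metis imageI)
    qed
  qed
  show "covering_map trunc full.lex_covering lex_covering"
  proof (rule covering_mapI[OF full.listed_lex_covering listed_lex_covering])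
    show "lex_inits = map trunc full.lex_inits"
      by (simp only: lex_inits_def full.lex_inits_def * list.map_id)
    show "lex_succs (trunc r) a = map trunc (full.lex_succs r a)" for r a
      by (simp only: lex_succs_trunc full.lex_succs_def * list.map_id)
  qed (use img in \<open>auto simp: full.lex_covering_def lex_covering_def\<close>)
qed

lemma card_lex_covering:
  assumes "finite (range t)"
  shows "finite (states lex_covering)"
    and "card (states lex_covering) \<le> card (states A) * card (range t) ^ card (states A)"
proof -
  let ?F = "states A \<rightarrow>\<^sub>E range t"
  \<comment> \<open>Vectors vanish outside the states, so restriction embeds them into a finite
    function space.\<close>
  have inj: "inj_on (\<lambda>v. restrict v (states A)) vectors"
  proof (rule inj_onI, rule ext)
    fix v w q
    assume "v \<in> vectors" "w \<in> vectors" "restrict v (states A) = restrict w (states A)"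
    then show "v q = w q"
      by (cases "q \<in> states A") (auto simp: vectors_def dest: fun_cong[of _ _ q])
  qed
  have sub: "(\<lambda>v. restrict v (states A)) ` vectors \<subseteq> ?F"
    by (auto simp: vectors_def)
  have fin: "finite ?F" by (intro finite_PiE finite_states assms)
  have "finite vectors"
    using inj_on_finite[OF inj sub fin] .
  then show "finite (states lex_covering)"
    by (simp add: lex_covering_def finite_states)
  have "card vectors \<le> card ?F"
    by (rule card_inj_on_le[OF inj sub fin])
  also have "\<dots> = card (range t) ^ card (states A)"
    by (rule card_funcsetE[OF finite_states])
  finally show "card (states lex_covering) \<le> card (states A) * card (range t) ^ card (states A)"
    by (simp add: lex_covering_def card_cartesian_product)
qed

end

section \<open>From the truncations \<open>id\<close> and \<open>min k\<close> to the required
  automata\<close>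

theorem theorem1p3:
  fixes A :: "('q, 'a) n_automaton" and s :: "'a list \<Rightarrow> nat" and n :: nat
  assumes "finite (alphabet A)"
    and "finite (states A)" and "card (states A) = n" and "n > 0"
    and "realises A s"
  shows "\<exists>B :: ('q \<times> ('q \<Rightarrow> nat), 'a) n_automaton.
    infinite (states B) \<and> is_covering_of B A \<and>
    (\<forall>k::nat. k > 0 \<longrightarrow>
      (\<exists>Bk :: ('q \<times> ('q \<Rightarrow> nat), 'a) n_automaton.
        finite (states Bk) \<and> is_quotient_of Bk B \<and>
        is_covering_of Bk A \<and> card (states Bk) \<le> n * (k + 1) ^ n \<and>
        (\<forall>i<k. \<exists>C. subautomaton C Bk \<and> unambiguous C \<and>
           recognised_language C = series_support (alphabet A) (series_minus s i)) \<and>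
        (\<exists>D. subautomaton D Bk \<and> realises D (series_minus s k))))"
proof -
  obtain qs where qs: "distinct qs" "set qs = states A"
    using finite_distinct_list[OF assms(2)] by blast
  interpret ordered_automaton A qs
    by unfold_locales (rule qs)+
  have s: "behaviour A u = s u" if "u \<in> lists (alphabet A)" for u
    using assms(5) that by (simp add: realises_def)
  show ?thesis
  proof (rule exI[of _ full.lex_covering], intro conjI allI impI)
    show "infinite (states full.lex_covering)"
      using assms(3,4) by (intro infinite_full_covering) auto
    show "is_covering_of full.lex_covering A"
      unfolding is_covering_of_def using full.covering_fst by blast
    fix k :: nat
    interpret B: truncated_ordered_automaton A qs "min k"
      by (intro truncated_ordered_automaton.intro ordered_automaton_axioms truncation_min)
    \<comment> \<open>A coordinate takes \<open>k + 1\<close> values, which is the base of the power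
      in the bound.\<close>
    have range: "range (min k) = {..k}"
    proof
      show "{..k} \<subseteq> range (min k)"
        by (auto simp: image_iff min_def intro!: exI)
    qed auto
    have fin: "finite (states B.lex_covering)"
      by (rule B.card_lex_covering) (simp add: range)
    then have fin': "finite (states (B.ranked_part R))" for R
      by (simp add: B.ranked_part_def)
    have alph: "alphabet (B.ranked_part R) = alphabet A" for R
      by (simp add: B.ranked_part_def B.lex_covering_def)
    show "\<exists>Bk :: ('q \<times> ('q \<Rightarrow> nat), 'a) n_automaton.
        finite (states Bk) \<and> is_quotient_of Bk full.lex_covering \<and>
        is_covering_of Bk A \<and> card (states Bk) \<le> n * (k + 1) ^ n \<and>
        (\<forall>i<k. \<exists>C. subautomaton C Bk \<and> unambiguous C \<and>
           recognised_language C = series_support (alphabet A) (series_minus s i)) \<and>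
        (\<exists>D. subautomaton D Bk \<and> realises D (series_minus s k))"
    proof (rule exI[of _ B.lex_covering], intro conjI allI impI)
      show "finite (states B.lex_covering)" by (rule fin)
      show "is_quotient_of B.lex_covering full.lex_covering" by (rule B.quotient_of_full)
      show "is_covering_of B.lex_covering A"
        unfolding is_covering_of_def using B.covering_fst by blast
      show "card (states B.lex_covering) \<le> n * (k + 1) ^ n"
        using B.card_lex_covering(2) assms(3) by (simp add: range)
      show "\<exists>C. subautomaton C B.lex_covering \<and> unambiguous C \<and>
          recognised_language C = series_support (alphabet A) (series_minus s i)" if "i < k" for i
      proof (rule exI[of _ "B.ranked_part {i}"], intro conjI)
        have "behaviour (B.ranked_part {i}) u = card {j \<in> {i}. j < behaviour A u}" for u
          \<comment> \<open>For \<open>i < k\<close> the class of \<open>i\<close> under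
            \<open>min k\<close> is \<open>{i}\<close> alone; for \<open>i = k\<close> it would not
            be.\<close>
          by (rule B.behaviour_ranked_part) (use that in \<open>auto simp: min_def\<close>)
        moreover have "{j \<in> {i}. j < m} = (if i < m then {i} else {})" for m
          by auto
        ultimately have b: "behaviour (B.ranked_part {i}) u = (if i < behaviour A u then 1 else 0)" for u
          by simp
        show "subautomaton (B.ranked_part {i}) B.lex_covering"
          by (rule B.subautomaton_ranked_part)
        show "unambiguous (B.ranked_part {i})"
          by (rule unambiguousI[OF fin']) (simp add: b)
        show "recognised_language (B.ranked_part {i}) = series_support (alphabet A) (series_minus s i)"
          unfolding recognised_language_eq_support[OF fin'] alph series_support_def
          by (intro Collect_cong conj_cong refl) (simp add: series_minus_def b s)
      qed
      show "\<exists>D. subautomaton D B.lex_covering \<and> realises D (series_minus s k)"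
      proof (rule exI[of _ "B.ranked_part {k..}"], intro conjI)
        have "behaviour (B.ranked_part {k..}) u = card {j \<in> {k..}. j < behaviour A u}" for u
          \<comment> \<open>The set \<open>{k..}\<close> is a single class, that of
            \<open>k\<close>. Its part below \<open>m\<close> has \<open>m - k\<close> elements,
            with truncated subtraction.\<close>
          by (rule B.behaviour_ranked_part) auto
        moreover have "{j \<in> {k..}. j < m} = {k..<m}" for m
          by auto
        ultimately show "realises (B.ranked_part {k..}) (series_minus s k)"
          by (simp add: realises_def alph series_minus_def s)
      qed (rule B.subautomaton_ranked_part)
    qed
  qed
qed

end
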